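(* Let $(X,d)$ be a compact metric space, let $f\colon X\to X$ be continuous, and let $M\subseteq X$. If $f$ is ball expanding on $M$, then $f$ has h-shadowing on $M$.
   Context: $B_\varepsilon(x)=\{y\in X: d(x,y)<\varepsilon\}$ denotes the open ball. $f$ is ball expanding on $M\subseteq X$ if there are $\mu>1$ and $\nu>0$ such that for every $x\in M$ and every $0<\varepsilon<\nu$ one has $B_{\mu\varepsilon}(f(x))\subseteq f(B_\varepsilon(x))$. For $\delta>0$, a finite sequence $x_0,\dots,x_m$ in $X$ is a $\delta$-pseudo-orbit if $d(f(x_i),x_{i+1})<\delta$ for all $0\le i<m$. $f$ has h-shadowing on $Y\subseteq X$ if for every $\varepsilon>0$ there is $\delta>0$ such that for every finite $\delta$-pseudo-orbit $\{x_0,\dots,x_m\}\subseteq Y$ there is $y\in X$ with $d(f^i(y),x_i)<\varepsilon$ for every $i<m$ and $f^m(y)=x_m$. *)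

theory Defs
  imports "HOL-Analysis.Analysis"
begin

definition ball_expanding_on ::
    "'a set \<Rightarrow> ('a \<Rightarrow> 'a \<Rightarrow> real) \<Rightarrow> ('a \<Rightarrow> 'a) \<Rightarrow> 'a set \<Rightarrow> bool" where
  "ball_expanding_on X d f M \<longleftrightarrow>
     (\<exists>\<mu>>1. \<exists>\<nu>>0. \<forall>x\<in>M. \<forall>\<epsilon>. 0 < \<epsilon> \<and> \<epsilon> < \<nu> \<longrightarrow>
        Metric_space.mball X d (f x) (\<mu> * \<epsilon>) \<subseteq> f ` Metric_space.mball X d x \<epsilon>)"

text \<open>A finite sequence of length \<open>m + 1\<close> is encoded by the values at \<open>0, \<dots>, m\<close> of a function
  on the naturals; its values beyond \<open>m\<close> are irrelevant.\<close>

definition pseudo_orbit ::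
    "'a set \<Rightarrow> ('a \<Rightarrow> 'a \<Rightarrow> real) \<Rightarrow> ('a \<Rightarrow> 'a) \<Rightarrow> real \<Rightarrow> nat \<Rightarrow> (nat \<Rightarrow> 'a) \<Rightarrow> bool" where
  "pseudo_orbit X d f \<delta> m x \<longleftrightarrow>
     (\<forall>i\<le>m. x i \<in> X) \<and> (\<forall>i<m. d (f (x i)) (x (Suc i)) < \<delta>)"

definition h_shadowing_on ::
    "'a set \<Rightarrow> ('a \<Rightarrow> 'a \<Rightarrow> real) \<Rightarrow> ('a \<Rightarrow> 'a) \<Rightarrow> 'a set \<Rightarrow> bool" where
  "h_shadowing_on X d f Y \<longleftrightarrow>
     (\<forall>\<epsilon>>0. \<exists>\<delta>>0. \<forall>m x. pseudo_orbit X d f \<delta> m x \<and> (\<forall>i\<le>m. x i \<in> Y) \<longrightarrow>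
        (\<exists>y\<in>X. (\<forall>i<m. d ((f ^^ i) y) (x i) < \<epsilon>) \<and> (f ^^ m) y = x m))"

end

theory Submission
  imports Defs
begin

text \<open>The shadowing point is built backwards from the end of the pseudo-orbit, at one fixed
  scale e with jumps below (\<mu> - 1) * e. Start with the last point itself. If z lies within e of
  x_{i+1}, then z lies within (\<mu> - 1) * e + e = \<mu> * e of f(x_i), so ball expansion at x_i
  gives an exact preimage of z within e of x_i. The error thus never grows, however long the
  pseudo-orbit, and the last point is hit exactly because every pullback is exact.
  \<open>exact_end_shadowing\<close> carries out this induction; the theorem only chooses the
  scale.\<close>

lemma (in Metric_space) exact_end_shadowing:
  assumes f: "f ` M \<subseteq> M"
    and expand: "\<And>u. u \<in> A \<Longrightarrow> mball (f u) (\<mu> * e) \<subseteq> f ` mball u e"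
    and "0 < e"
    and "pseudo_orbit M d f ((\<mu> - 1) * e) m x" "\<forall>i\<le>m. x i \<in> A"
  shows "\<exists>y\<in>M. (\<forall>i\<le>m. d ((f ^^ i) y) (x i) < e) \<and> (f ^^ m) y = x m"
  using assms(4,5)
proof (induction m arbitrary: x)
  case 0
  then show ?case
    using \<open>0 < e\<close> by (auto simp: pseudo_orbit_def)
next
  case (Suc m)
  have orb: "\<And>i. i \<le> Suc m \<Longrightarrow> x i \<in> M"
    and step: "\<And>i. i < Suc m \<Longrightarrow> d (f (x i)) (x (Suc i)) < (\<mu> - 1) * e"
    using Suc.prems(1) by (auto simp: pseudo_orbit_def)
  \<comment> \<open>Drop the first point: z will follow the tail, and a preimage y of z near
    \<open>x 0\<close> will follow the whole sequence.\<close>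
  have "pseudo_orbit M d f ((\<mu> - 1) * e) m (\<lambda>i. x (Suc i))"
    using orb step by (simp add: pseudo_orbit_def)
  then obtain z where z: "z \<in> M" "\<And>i. i \<le> m \<Longrightarrow> d ((f ^^ i) z) (x (Suc i)) < e"
      "(f ^^ m) z = x (Suc m)"
    using Suc.IH[of "\<lambda>i. x (Suc i)"] Suc.prems(2) by auto
  have fx: "f (x 0) \<in> M" and x1: "x (Suc 0) \<in> M"
    using f orb by auto
  have "d (f (x 0)) z \<le> d (f (x 0)) (x (Suc 0)) + d z (x (Suc 0))"
    using triangle[OF fx x1 z(1)] by (simp add: commute)
  \<comment> \<open>The bound on z at index 0 is at hand even for a tail of a single point, since
    the claim proved by induction includes the end index.\<close>
  also have "\<dots> < (\<mu> - 1) * e + e"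
    using step[of 0] z(2)[of 0] by simp
  finally have "z \<in> mball (f (x 0)) (\<mu> * e)"
    using fx z(1) by (simp add: algebra_simps)
  then have "z \<in> f ` mball (x 0) e"
    using expand[of "x 0"] Suc.prems(2) by blast
  then obtain y where y: "y \<in> M" "d (x 0) y < e" "f y = z"
    by auto
  have "d ((f ^^ i) y) (x i) < e" if "i \<le> Suc m" for i
  proof (cases i)
    case 0
    then show ?thesis
      using y(2) by (simp add: commute)
  next
    case (Suc j)
    then show ?thesis
      using that y(3) z(2)[of j] by (simp add: funpow_Suc_right del: funpow.simps(2))
  qed
  moreover have "(f ^^ Suc m) y = x (Suc m)"
    using y(3) z(3) by (simp add: funpow_Suc_right del: funpow.simps(2))
  ultimately show ?case
    using y(1) by blast
qed

theorem theorem4p3: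
  fixes X M :: "'a set" and d :: "'a \<Rightarrow> 'a \<Rightarrow> real" and f :: "'a \<Rightarrow> 'a"
  assumes "Metric_space X d"
    and "compact_space (Metric_space.mtopology X d)"
    and "continuous_map (Metric_space.mtopology X d) (Metric_space.mtopology X d) f"
    and "M \<subseteq> X"
    and "ball_expanding_on X d f M"
  shows "h_shadowing_on X d f M"
proof -
  interpret Metric_space X d by fact
  have f: "f ` X \<subseteq> X"
    using continuous_map_image_subset_topspace[OF assms(3)] by simp
  obtain \<mu> \<nu> where "\<mu> > 1" "\<nu> > 0"
    and expand: "\<And>u \<epsilon>. \<lbrakk>u \<in> M; 0 < \<epsilon>; \<epsilon> < \<nu>\<rbrakk> \<Longrightarrow> mball (f u) (\<mu> * \<epsilon>) \<subseteq> f ` mball u \<epsilon>"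
    using assms(5) unfolding ball_expanding_on_def by blast
  show ?thesis
    unfolding h_shadowing_on_def
  proof (intro allI impI)
    fix \<epsilon> :: real
    assume "\<epsilon> > 0"
    \<comment> \<open>Halving \<nu> keeps e strictly inside the range where balls expand. The
      witness for \<delta> is then (\<mu> - 1) * e, independent of m and x.\<close>
    define e where "e = min \<epsilon> (\<nu> / 2)"
    have e: "0 < e" "e \<le> \<epsilon>" "e < \<nu>"
      using \<open>\<epsilon> > 0\<close> \<open>\<nu> > 0\<close> by (auto simp: e_def)
    have "\<exists>y\<in>X. (\<forall>i<m. d ((f ^^ i) y) (x i) < \<epsilon>) \<and> (f ^^ m) y = x m"
      if "pseudo_orbit X d f ((\<mu> - 1) * e) m x" "\<forall>i\<le>m. x i \<in> M" for m x
      using exact_end_shadowing[OF f expand[OF _ e(1,3)] e(1) that] e(2)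
      by (meson less_imp_le order_less_le_trans)
    moreover have "(\<mu> - 1) * e > 0"
      using \<open>\<mu> > 1\<close> e(1) by simp
    ultimately show "\<exists>\<delta>>0. \<forall>m x. pseudo_orbit X d f \<delta> m x \<and> (\<forall>i\<le>m. x i \<in> M) \<longrightarrow>
        (\<exists>y\<in>X. (\<forall>i<m. d ((f ^^ i) y) (x i) < \<epsilon>) \<and> (f ^^ m) y = x m)"
      by blast
  qed
qed

end
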